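(* In the setting described in the context, let $\{f_k,g_k,x_k,y_k\}_{k\ge 0}$ be generated by $$f_{k+1}=(1-\lambda_k)f_k+\lambda_k\big(F(x_k,y_k)+\xi_k\big),\quad x_{k+1}=x_k-\alpha_k f_k,$$ $$g_{k+1}=(1-\gamma_k)g_k+\gamma_k\big(G(x_k,y_k)+\psi_k\big),\quad y_{k+1}=y_k-\beta_k g_k,$$ with step sizes $\lambda_k=\frac{C_\lambda}{k+h+1}$, $\gamma_k=\frac{C_\gamma}{k+h+1}$, $\alpha_k=\frac{C_\alpha}{k+h+1}$, $\beta_k=\frac{C_\beta}{k+h+1}$, where $C_\lambda,C_\gamma,C_\alpha,C_\beta,h>0$ are constants such that for all $k\ge 0$: $\lambda_k=\gamma_k\le \frac14$ and $$\frac{\beta_k}{\alpha_k}\le\frac{\mu_F\mu_G}{32L^2(1+L)^4},$$ $$\alpha_k\le\min\Big\{\frac{\mu_F}{32L^2(L+1)^2},\ \frac{\mu_G}{L^4(1+L)^2}\Big\},$$ $$\frac{\alpha_k}{\lambda_k}\le\min\Big\{\frac{1}{24L},\ \frac{\mu_G}{144(1+\mu_G)},\ \frac{\mu_G}{192L^4(1+L)^2}\Big\}.$$ Let $$V_k=\|f_k-F(x_k,y_k)\|^2+\|g_k-G(x_k,y_k)\|^2+\|x_k-H(y_k)\|^2+\|y_k-y^\star\|^2 .$$ Then for all $k\ge 0$ $$\mathbb{E}[V_{k+1}]\le(1-\mu_G\beta_k)\,\mathbb{E}[V_k]+2\lambda_k^2\,\mathbb{E}\big[\|\xi_k\|^2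+\|\psi_k\|^2\big].$$
   Context: $\|\cdot\|$ is the Euclidean norm on $\mathbb{R}^d$, $d\ge1$. $F,G:\mathbb{R}^d\times\mathbb{R}^d\to\mathbb{R}^d$ are operators and $(x^\star,y^\star)$ satisfies $F(x^\star,y^\star)=0$, $G(x^\star,y^\star)=0$. Smoothness: there is an operator $H:\mathbb{R}^d\to\mathbb{R}^d$ with $F(H(y),y)=0$ for all $y\in\mathbb{R}^d$, and there is a constant $L>0$ such that for all $x_1,x_2,y_1,y_2\in\mathbb{R}^d$: $\|H(y_1)-H(y_2)\|\le L\|y_1-y_2\|$, $\|F(x_1,y_1)-F(x_2,y_2)\|\le L(\|x_1-x_2\|+\|y_1-y_2\|)$, $\|G(x_1,y_1)-G(x_2,y_2)\|\le L(\|x_1-x_2\|+\|y_1-y_2\|)$. Strong monotonicity: there is $\mu_F>0$ such that $\langle x-z,F(x,y)-F(z,y)\rangle\ge\mu_F\|x-z\|^2$ for all $x,y,z\in\mathbb{R}^d$; and there is $\mu_G\in(0,\mu_F]$ such that $\langle y-y^\star,G(H(y),y)\rangle\ge\mu_G\|y-y^\star\|^2$ for all $y\in\mathbb{R}^d$. Noise: $\xi_k,\psi_k$ ($k\ge0$) are $\mathbb{R}^d$-valued random vectors, independent of each other and across time, with zero mean. Let $\mathcal{Q}_k$ be the $\sigma$-algebra generated by the initial values $x_0,y_0,f_0,g_0$ and $\xi_0,\psi_0,\dots,\xi_k,\psi_k$ (with $\mathcal{Q}_{-1}$ generated by the initial values only). Then $\mathbb{E}[\xi_k\mid\mathcal{Q}_{k-1}]=\mathbb{E}[\psi_k\mid\mathcal{Q}_{k-1}]=0$,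 $\mathbb{E}[\xi_k^T\xi_k\mid\mathcal{Q}_{k-1}]=\Gamma_{11}$ and $\mathbb{E}[\psi_k^T\psi_k\mid\mathcal{Q}_{k-1}]=\Gamma_{22}$ for finite constants $\Gamma_{11},\Gamma_{22}\ge 0$. The initial values $x_0,y_0,f_0,g_0\in\mathbb{R}^d$ are arbitrary (deterministic, or random with finite second moments). *)

theory Defs
  imports "HOL-Probability.Probability"
begin

definition generated_sigma ::
  "'w measure \<Rightarrow> ('w \<Rightarrow> 'b::topological_space) set \<Rightarrow> 'w measure" where
  "generated_sigma M \<X> =
     sigma (space M) (\<Union>X\<in>\<X>. {X -` A \<inter> space M | A. A \<in> sets borel})"

(* The index is shifted by one: noise_history M I \<xi> \<psi> k is the sigma-algebra Q_{k-1} generated by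
   the initial values I and the noise at the times j < k.  In particular k = 0 gives Q_{-1}. *)
definition noise_history ::
  "'w measure \<Rightarrow> ('w \<Rightarrow> 'b::topological_space) set \<Rightarrow>
   (nat \<Rightarrow> 'w \<Rightarrow> 'b) \<Rightarrow> (nat \<Rightarrow> 'w \<Rightarrow> 'b) \<Rightarrow> nat \<Rightarrow> 'w measure" where
  "noise_history M I \<xi> \<psi> k = generated_sigma M (I \<union> (\<Union>j<k. {\<xi> j, \<psi> j}))"

(* real_cond_exp covers real-valued functions only; for random vectors the conditional expectation
   is taken coordinatewise. *)
definition vec_cond_exp ::
  "'w measure \<Rightarrow> 'w measure \<Rightarrow> ('w \<Rightarrow> real ^ 'n) \<Rightarrow> 'w \<Rightarrow> real ^ 'n" where
  "vec_cond_exp M Q X \<omega> = (\<chi> i. real_cond_exp M Q (\<lambda>\<omega>'. X \<omega>' $ i) \<omega>)"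

definition lyapunov ::
  "('b::real_normed_vector \<Rightarrow> 'b \<Rightarrow> 'b) \<Rightarrow> ('b \<Rightarrow> 'b \<Rightarrow> 'b) \<Rightarrow> ('b \<Rightarrow> 'b) \<Rightarrow> 'b \<Rightarrow>
   'b \<Rightarrow> 'b \<Rightarrow> 'b \<Rightarrow> 'b \<Rightarrow> real" where
  "lyapunov F G H ystar f g x y =
     (norm (f - F x y))\<^sup>2 + (norm (g - G x y))\<^sup>2 + (norm (x - H y))\<^sup>2 + (norm (y - ystar))\<^sup>2"

end

(* The iterates x (Suc k) and y (Suc k) do not depend on the noise at time k, so a step splits
   into a deterministic step plus noise that is orthogonal to everything known before.  For the
   deterministic step, Lipschitz continuity and monotonicity bound the new Lyapunov function by a
   quadratic form in the four residual norms; after scaling the residuals of f and g by sqrt l, that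
   of x by sqrt (a * n) and that of y by sqrt (b * m), its matrix is diagonally dominant.  Here
   n, m are the moduli of monotonicity and a, b, l the step sizes alpha_k, beta_k, lambda_k. *)
theory Submission
  imports Defs
begin

section \<open>Step sizes and the quadratic form of the residuals\<close>

text \<open>The four squared residuals decay at rates of different orders: about \<open>l\<close>
  for those of \<open>f\<close> and \<open>g\<close>, \<open>a * n\<close> for that of
  \<open>x\<close>, \<open>b * m\<close> for that of \<open>y\<close>. A coupling such as
  \<open>a * E * U\<close> is therefore harmless only relative to the geometric mean of the two
  rates involved, here \<open>sqrt (l * (a * n))\<close>. This is the origin of the square-root
  scaling: it turns the matrix into one with numerical entries, and the bounds on step-size ratios
  are what makes the off-diagonal ones small. The target rate \<open>m * b\<close> is the slowest of
  all. The \<open>y\<close> component decays at twice this rate, so one half of its decay pays for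
  the contraction factor and the other half must absorb the couplings into \<open>y\<close>. The
  hypotheses are stated here with denominators cleared, and \<open>n \<le> L\<close> is included
  because it lets powers of \<open>L\<close> dominate the monotonicity moduli.\<close>

locale step_sizes =
  fixes L n m a b l :: real
  assumes pos: "0 < a" "0 < b" "0 < l"
    and m: "0 < m" "m \<le> n" "n \<le> L"
    and l_le: "l \<le> 1 / 4"
    and ratio_ba: "32 * L\<^sup>2 * (1 + L) ^ 4 * b \<le> a * n * m"
    and bound_a: "32 * L\<^sup>2 * (1 + L)\<^sup>2 * a \<le> n"
    and ratio_al: "24 * L * a \<le> l" "144 * (1 + m) * a \<le> l * m" "192 * L ^ 4 * (1 + L)\<^sup>2 * a \<le> l * m"
begin

lemma L_pos: "0 < L" and n_pos: "0 < n"
  using m by auto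

lemma a_le: "144 * a \<le> l" "144 * a \<le> l * m"
proof -
  have "144 * a * (1 + m) \<le> l * m" using ratio_al(2) by (simp add: algebra_simps)
  moreover have "l * m \<le> l * (1 + m)" using pos by simp
  ultimately have "144 * a * (1 + m) \<le> l * (1 + m)" by linarith
  then show "144 * a \<le> l" using m by simp
  have "0 \<le> m * a" using pos m by simp
  then show "144 * a \<le> l * m" using ratio_al(2) by (simp add: algebra_simps)
qed

lemma le_mult_power: "0 \<le> c \<Longrightarrow> c \<le> c * (1 + L) ^ k"
  using L_pos mult_left_mono[of 1 "(1 + L) ^ k" c] by simp

text \<open>All five come from \<open>ratio_ba\<close> by spending factors of \<open>1 + L\<close>:
  they are dropped, or traded for \<open>m \<le> 1 + L\<close> (third bound) or for
  \<open>L\<^sup>2 \<le> (1 + L)\<^sup>2\<close> (fifth bound). The first bound follows from the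
  second since \<open>n * m \<le> L\<^sup>2\<close>.\<close>

lemma b_le: "32 * b \<le> a" "32 * L\<^sup>2 * b \<le> a * n * m" "32 * L\<^sup>2 * b \<le> a * n"
    "32 * L\<^sup>2 * (1 + L)\<^sup>2 * b \<le> a * n * m" "32 * L ^ 4 * (1 + L)\<^sup>2 * b \<le> a * n * m"
proof -
  have L: "0 < L" by (rule L_pos)
  have c: "0 \<le> 32 * L\<^sup>2 * b" using pos by simp
  show 2: "32 * L\<^sup>2 * b \<le> a * n * m"
    using le_mult_power[OF c, of 4] ratio_ba by (simp add: algebra_simps)
  have c': "0 \<le> 32 * L\<^sup>2 * (1 + L)\<^sup>2 * b" using pos by simp
  have "(1 + L)^4 = (1+L)\<^sup>2 * (1+L)\<^sup>2" by (simp flip: power_add)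
  then have h: "32 * L\<^sup>2 * (1 + L)\<^sup>2 * b * (1 + L)\<^sup>2 \<le> a * n * m"
    using ratio_ba by (simp add: mult_ac)
  show "32 * L\<^sup>2 * (1 + L)\<^sup>2 * b \<le> a * n * m"
    using le_mult_power[OF c', of 2] h by linarith
  have "L\<^sup>2 \<le> (1 + L)\<^sup>2" using L by (intro power_mono) auto
  then have "32 * L\<^sup>2 * (1 + L)\<^sup>2 * b * L\<^sup>2 \<le> 32 * L\<^sup>2 * (1 + L)\<^sup>2 * b * (1 + L)\<^sup>2"
    using c' by (intro mult_left_mono)
  then show "32 * L ^ 4 * (1 + L)\<^sup>2 * b \<le> a * n * m"
    using h by (simp add: mult_ac power2_eq_square power4_eq_xxxx)
  have "n * m \<le> L * L" using m by (intro mult_mono) auto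
  then have "a * (n * m) \<le> a * (L * L)" using pos by (intro mult_left_mono) auto
  with 2 have "L\<^sup>2 * (32 * b) \<le> L\<^sup>2 * a" by (simp add: power2_eq_square mult_ac)
  then show "32 * b \<le> a" using L by simp
  have "b * L\<^sup>2 * 32 \<le> a * n"
  proof -
    have "32 * L\<^sup>2 * b * (1 + L) \<le> 32 * L\<^sup>2 * b * (1 + L) ^ 4"
      using c L by (intro mult_left_mono self_le_power) auto
    also have "\<dots> \<le> a * n * m" using ratio_ba by (simp add: mult_ac)
    also have "\<dots> \<le> a * n * (1 + L)" using pos m by (intro mult_left_mono) auto
    finally show ?thesis using L by (simp add: mult_ac)
  qed
  then show "32 * L\<^sup>2 * b \<le> a * n" by (simp add: mult_ac)
qed

lemma an_le: "32 * (a * n) \<le> 1" "32 * L\<^sup>2 * a \<le> n"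
proof -
  have c: "0 \<le> 32 * L\<^sup>2 * a" using pos by simp
  show 2: "32 * L\<^sup>2 * a \<le> n"
    using le_mult_power[OF c, of 2] bound_a by (simp add: mult_ac)
  have "32 * (a * n) * n \<le> 32 * L\<^sup>2 * a"
  proof -
    have "n * n \<le> L * L" using m by (intro mult_mono) auto
    then have "a * (n * n) \<le> a * (L * L)" using pos by (intro mult_left_mono) auto
    then show ?thesis by (simp add: power2_eq_square mult_ac)
  qed
  with 2 have "32 * (a * n) * n \<le> 1 * n" by simp
  then show "32 * (a * n) \<le> 1" using n_pos by (simp only: mult_le_cancel_right_pos)
qed

text \<open>The target rate is small against the decay rates of the other components, so asking them
  to contract by \<open>1 - m * b\<close> as well costs almost nothing. The constant 768 is 24 * 32,
  from \<open>24 * L * a \<le> l\<close> and \<open>32 * b \<le> a\<close>.\<close>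

lemma mb_le: "768 * (m * b) \<le> l" "32 * (m * b) \<le> a * n"
proof -
  have "m * (32 * b) \<le> m * a" using b_le(1) m by (intro mult_left_mono) auto
  moreover have "m * a \<le> L * a" "m * a \<le> n * a" using m pos by (auto intro!: mult_right_mono)
  ultimately show "768 * (m * b) \<le> l" "32 * (m * b) \<le> a * n" using ratio_al(1)
    by (auto simp: mult_ac)
qed

text \<open>The constant 4608 is 32 * 144, obtained by chaining \<open>32 * b \<le> a\<close> with
  \<open>a_le\<close>.\<close>

lemma b_le_l: "4608 * b \<le> l" "4608 * b \<le> l * m" "b \<le> 1 / 4608"
  using b_le(1) a_le l_le by linarith+

text \<open>Each coupling coefficient of the quadratic form is compared with the product of the
  roots of the two decay rates that it links. Squaring removes the roots and leaves an inequality
  between step sizes. The integers are chosen so that their squares fit: 169 below 192, 4096 below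
  both 192 * 32 and 4608, and 25 below 32.\<close>

lemma sqrt_coefficients:
  defines "s \<equiv> sqrt l" and "p \<equiv> sqrt (a * n)" and "r \<equiv> sqrt (b * m)"
  shows "13 * (L\<^sup>2 * a) \<le> s * p" "64 * (L\<^sup>2 * (1 + L) * b) \<le> s * r" "12 * a \<le> s * p"
    "32 * (L * b) \<le> s * p" "5 * (L\<^sup>2 * (1 + L) * b) \<le> p * r" "64 * b \<le> s * r" "5 * (L * b) \<le> p * r"
    "64 * b \<le> s" "16 * (b * L) \<le> p" "32 * (b * L * (1 + L)) \<le> r"
proof -
  note pos' = pos m(1) n_pos L_pos
  have sq: "s\<^sup>2 = l" "p\<^sup>2 = a * n" "r\<^sup>2 = b * m"
    and nn: "0 \<le> s" "0 \<le> p" "0 \<le> r"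
    using pos' by (auto simp: s_def p_def r_def)
  have lm: "l * m \<le> l * n" using pos m by simp
  have c4: "L ^ 4 * a * 192 \<le> l * m"
  proof -
    have "192 * L ^ 4 * a \<le> 192 * L ^ 4 * a * (1 + L)\<^sup>2"
      using pos by (intro le_mult_power) auto
    also have "\<dots> = 192 * L ^ 4 * (1 + L)\<^sup>2 * a" by (simp add: mult_ac)
    also have "\<dots> \<le> l * m" by (rule ratio_al(3))
    finally show ?thesis by (simp add: mult_ac)
  qed
  have "(13 * (L\<^sup>2 * a))\<^sup>2 \<le> (s * p)\<^sup>2"
  proof -
    have "0 \<le> L ^ 4 * a" using pos' by simp
    then have "169 * (L ^ 4 * a) \<le> l * n" using c4 lm by linarith
    then have "a * (169 * (L ^ 4 * a)) \<le> a * (l * n)" using pos by (intro mult_left_mono) auto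
    then show ?thesis unfolding power_mult_distrib sq by (simp add: power2_eq_square power4_eq_xxxx mult_ac)
  qed
  then show "13 * (L\<^sup>2 * a) \<le> s * p" by (rule power2_le_imp_le) (use nn in auto)
  have "(64 * (L\<^sup>2 * (1 + L) * b))\<^sup>2 \<le> (s * r)\<^sup>2"
  proof -
    have "192 * L ^ 4 * (1 + L)\<^sup>2 * (32 * b) \<le> 192 * L ^ 4 * (1 + L)\<^sup>2 * a"
      using b_le(1) by (intro mult_left_mono) auto
    moreover have "0 \<le> L ^ 4 * (1 + L)\<^sup>2 * b" using pos' by simp
    ultimately have "4096 * (L ^ 4 * (1 + L)\<^sup>2 * b) \<le> l * m" using ratio_al(3) by linarith
    then have "b * (4096 * (L ^ 4 * (1 + L)\<^sup>2 * b)) \<le> b * (l * m)" using pos by (intro mult_left_mono) auto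
    then show ?thesis unfolding power_mult_distrib sq by (simp add: power2_eq_square power4_eq_xxxx mult_ac)
  qed
  then show "64 * (L\<^sup>2 * (1 + L) * b) \<le> s * r" by (rule power2_le_imp_le) (use nn in auto)
  have "(12 * a)\<^sup>2 \<le> (s * p)\<^sup>2"
  proof -
    have "144 * a \<le> l * n" using a_le(2) lm by linarith
    then have "a * (144 * a) \<le> a * (l * n)" using pos by (intro mult_left_mono) auto
    then show ?thesis unfolding power_mult_distrib sq by (simp add: power2_eq_square mult_ac)
  qed
  then show "12 * a \<le> s * p" by (rule power2_le_imp_le) (use nn in auto)
  have "(32 * (L * b))\<^sup>2 \<le> (s * p)\<^sup>2"
  proof -
    have "(32 * b) * (32 * L\<^sup>2 * b) \<le> l * (a * n)"
      by (rule mult_mono) (use b_le(3) b_le_l(1) pos' in auto)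
    then show ?thesis unfolding power_mult_distrib sq by (simp add: power2_eq_square mult_ac)
  qed
  then show "32 * (L * b) \<le> s * p" by (rule power2_le_imp_le) (use nn in auto)
  have "(5 * (L\<^sup>2 * (1 + L) * b))\<^sup>2 \<le> (p * r)\<^sup>2"
  proof -
    have "0 \<le> L ^ 4 * (1 + L)\<^sup>2 * b" using pos' by simp
    then have "25 * (L ^ 4 * (1 + L)\<^sup>2 * b) \<le> a * n * m" using b_le(5) by linarith
    then have "b * (25 * (L ^ 4 * (1 + L)\<^sup>2 * b)) \<le> b * (a * n * m)" using pos by (intro mult_left_mono) auto
    then show ?thesis unfolding power_mult_distrib sq by (simp add: power2_eq_square power4_eq_xxxx mult_ac)
  qed
  then show "5 * (L\<^sup>2 * (1 + L) * b) \<le> p * r" by (rule power2_le_imp_le) (use nn in auto)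
  have "(64 * b)\<^sup>2 \<le> (s * r)\<^sup>2"
  proof -
    have "b * (4096 * b) \<le> b * (l * m)" using pos b_le_l(2) by (intro mult_left_mono) auto
    then show ?thesis unfolding power_mult_distrib sq by (simp add: power2_eq_square mult_ac)
  qed
  then show "64 * b \<le> s * r" by (rule power2_le_imp_le) (use nn in auto)
  have "(5 * (L * b))\<^sup>2 \<le> (p * r)\<^sup>2"
  proof -
    have "0 \<le> L\<^sup>2 * b" using pos' by simp
    then have "25 * (L\<^sup>2 * b) \<le> a * n * m" using b_le(2) by linarith
    then have "b * (25 * (L\<^sup>2 * b)) \<le> b * (a * n * m)" using pos by (intro mult_left_mono) auto
    then show ?thesis unfolding power_mult_distrib sq by (simp add: power2_eq_square mult_ac)
  qed
  then show "5 * (L * b) \<le> p * r" by (rule power2_le_imp_le) (use nn in auto)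
  \<comment> \<open>The remaining three bounds contain a single root. They control \<open>N\<close>,
    the length of the step in \<open>y\<close>, which enters the form squared and without a second
    residual as a factor.\<close>
  have "(64 * b)\<^sup>2 \<le> s\<^sup>2"
  proof -
    have "b * (4096 * b) \<le> 1 * l" using pos b_le_l by (intro mult_mono) auto
    then show ?thesis unfolding power_mult_distrib sq by (simp add: power2_eq_square mult_ac)
  qed
  then show "64 * b \<le> s" by (rule power2_le_imp_le) (use nn in auto)
  have "(16 * (b * L))\<^sup>2 \<le> p\<^sup>2"
  proof -
    have "(8 * b) * (32 * L\<^sup>2 * b) \<le> 1 * (a * n)"
      by (rule mult_mono) (use b_le(3) b_le_l(3) pos' in auto)
    then show ?thesis unfolding power_mult_distrib sq by (simp add: power2_eq_square mult_ac)
  qed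
  then show "16 * (b * L) \<le> p" by (rule power2_le_imp_le) (use nn in auto)
  have "(32 * (b * L * (1 + L)))\<^sup>2 \<le> r\<^sup>2"
  proof -
    have "m * (32 * (a * n)) \<le> m * 1" using an_le(1) m by (intro mult_left_mono) auto
    then have "1024 * (L\<^sup>2 * (1 + L)\<^sup>2 * b) \<le> m" using b_le(4) by (simp add: mult_ac)
    then have "b * (1024 * (L\<^sup>2 * (1 + L)\<^sup>2 * b)) \<le> b * m" using pos by (intro mult_left_mono) auto
    then show ?thesis unfolding power_mult_distrib sq by (simp add: power2_eq_square mult_ac)
  qed
  then show "32 * (b * L * (1 + L)) \<le> r" by (rule power2_le_imp_le) (use nn in auto)
qed

text \<open>\<open>E\<close>, \<open>Q\<close>, \<open>U\<close>, \<open>V\<close> stand for the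
  residual norms of \<open>f\<close>, \<open>g\<close>, \<open>x\<close>, \<open>y\<close>.
  \<open>N\<close> bounds the length of the step in \<open>y\<close>, \<open>D\<close> the drift of
  \<open>F\<close> and \<open>G\<close> along one step, and \<open>W\<close> the disturbance of the
  \<open>x\<close> residual caused by the error in \<open>f\<close> and by the motion of
  \<open>H y\<close>. The four summands on the left bound the four new squared residuals.\<close>

lemma quadratic_form_le:
  fixes E Q U V :: real
  assumes nonneg: "0 \<le> E" "0 \<le> Q" "0 \<le> U" "0 \<le> V"
  defines "N \<equiv> b * (Q + L * U + L * (1 + L) * V)"
  defines "D \<equiv> L * (a * (E + L * U) + N)" and "W \<equiv> a * E + L * N"
  shows "((1 - l) * E + D)\<^sup>2 + ((1 - l) * Q + D)\<^sup>2
    + ((1 - 2 * a * n + (a * L)\<^sup>2) * U\<^sup>2 + 2 * U * W + W\<^sup>2)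
    + ((1 - 2 * m * b) * V\<^sup>2 + 2 * b * V * (Q + L * U) + N\<^sup>2)
    \<le> (1 - m * b) * (E\<^sup>2 + Q\<^sup>2 + U\<^sup>2 + V\<^sup>2)"
proof -
  define s p r where "s = sqrt l" and "p = sqrt (a * n)" and "r = sqrt (b * m)"
  define e q u v where "e = s * E" and "q = s * Q" and "u = p * U" and "v = r * V"
  define S where "S = e + q + u + v"
  \<comment> \<open>The weights of \<open>w\<close> and \<open>z\<close> are the reciprocals of the
    constants in \<open>sqrt_coefficients\<close>, so that \<open>W \<le> p * w\<close> and
    \<open>N \<le> z\<close>. The weight of \<open>u\<close> in \<open>w\<close> instead comes from
    \<open>32 * L\<^sup>2 * b \<le> a * n\<close>.\<close>
  define w where "w = e / 12 + q / 32 + u / 32 + v / 5"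
  define z where "z = q / 64 + u / 16 + v / 32"
  note coef = sqrt_coefficients[folded s_def p_def r_def]
  note pos' = pos m(1) n_pos L_pos
  have sq: "s\<^sup>2 = l" "p\<^sup>2 = a * n" "r\<^sup>2 = b * m"
    and nn: "0 \<le> s" "0 \<le> p" "0 \<le> r"
    using pos' by (auto simp: s_def p_def r_def)
  have nn': "0 \<le> e" "0 \<le> q" "0 \<le> u" "0 \<le> v"
    using nn nonneg by (auto simp: e_def q_def u_def v_def)
  have nonnegs: "0 \<le> N" "0 \<le> D" "0 \<le> W" "0 \<le> S" "0 \<le> w" "0 \<le> z"
    using pos' nonneg nn' by (auto simp: N_def D_def W_def S_def w_def z_def)
  note scale = mult_right_mono[OF _ nonneg(1)] mult_right_mono[OF _ nonneg(2)]
    mult_right_mono[OF _ nonneg(3)] mult_right_mono[OF _ nonneg(4)]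
  have N: "N \<le> z"
    unfolding N_def z_def q_def u_def v_def
    using scale(2)[OF coef(8)] scale(3)[OF coef(9)] scale(4)[OF coef(10)]
    by (simp add: algebra_simps)
  have W: "W \<le> p * w"
    using scale(1)[OF coef(3)] scale(2)[OF coef(4)] scale(4)[OF coef(5)] scale(3)[OF b_le(3)]
    unfolding W_def N_def w_def e_def q_def u_def v_def
    by (simp add: algebra_simps power2_eq_square flip: sq(2))
  \<comment> \<open>The common factor 1/12 is dictated by the coefficient of \<open>U\<close>, where
    1/13 + 1/416 is just below 1/12; here 416 = 13 * 32.\<close>
  have D: "D \<le> s * (S / 12)"
  proof -
    have 1: "24 * (L * a * E) \<le> s\<^sup>2 * E" using scale(1)[OF ratio_al(1)] sq by (simp add: mult_ac)
    have "L * (32 * b) \<le> L * a" using b_le(1) pos' by (intro mult_left_mono) auto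
    then have "768 * (L * b) \<le> s\<^sup>2" using ratio_al(1) sq by (simp add: mult_ac)
    from scale(2)[OF this] have 2: "768 * (L * b * Q) \<le> s\<^sup>2 * Q" by (simp only: mult.assoc)
    from scale(3)[OF coef(1)] have 3: "13 * (L\<^sup>2 * a * U) \<le> s * p * U" by (simp only: mult.assoc)
    have "L\<^sup>2 * (32 * b) \<le> L\<^sup>2 * a" using b_le(1) by (intro mult_left_mono) auto
    then have "416 * (L\<^sup>2 * b) \<le> s * p" using coef(1) by (simp add: mult_ac)
    from scale(3)[OF this] have 4: "416 * (L\<^sup>2 * b * U) \<le> s * p * U" by (simp only: mult.assoc)
    from scale(4)[OF coef(2)] have 5: "64 * (L\<^sup>2 * (1 + L) * b * V) \<le> s * r * V" by (simp only: mult.assoc)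
    have *: "0 \<le> s\<^sup>2 * E" "0 \<le> s\<^sup>2 * Q" "0 \<le> s * p * U" "0 \<le> s * r * V" using nn nonneg by auto
    have "D = L * a * E + L * b * Q + L\<^sup>2 * a * U + L\<^sup>2 * b * U + L\<^sup>2 * (1 + L) * b * V"
      unfolding D_def N_def by (simp add: algebra_simps power2_eq_square)
    also have "\<dots> \<le> (s\<^sup>2 * E + s\<^sup>2 * Q + s * p * U + s * r * V) / 12"
      using 1 2 3 4 5 * by argo
    also have "\<dots> = s * (S / 12)"
      unfolding S_def e_def q_def u_def v_def by (simp add: algebra_simps power2_eq_square)
    finally show ?thesis .
  qed
  \<comment> \<open>Both numerical losses come from \<open>l \<le> 1 / 4\<close>: the decay
    \<open>2 * l\<close> shrinks to \<open>7 / 4 * l\<close>, and the factor \<open>l\<close> in the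
    bound for the square of \<open>D\<close> turns 144 into 576.\<close>
  have fast: "((1 - l) * X + D)\<^sup>2 \<le> X\<^sup>2 - 7 / 4 * (s * X)\<^sup>2 + s * X * S / 6 + S\<^sup>2 / 576"
    if X: "0 \<le> X" for X
  proof -
    have "((1 - l) * X + D)\<^sup>2 = (1 - l)\<^sup>2 * X\<^sup>2 + 2 * ((1 - l) * (X * D)) + D\<^sup>2"
      by (simp add: power2_eq_square algebra_simps)
    moreover have "(1 - l)\<^sup>2 * X\<^sup>2 \<le> X\<^sup>2 - 7 / 4 * (s * X)\<^sup>2"
    proof -
      have "l * l \<le> l * (1 / 4)" using l_le pos by (intro mult_left_mono) auto
      then have "(1 - l)\<^sup>2 \<le> 1 - 7 / 4 * l" by (simp add: power2_eq_square algebra_simps)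
      then have "(1 - l)\<^sup>2 * X\<^sup>2 \<le> (1 - 7 / 4 * l) * X\<^sup>2" by (rule mult_right_mono) simp
      also have "\<dots> = X\<^sup>2 - 7 / 4 * (s * X)\<^sup>2" by (simp add: power_mult_distrib sq algebra_simps)
      finally show ?thesis .
    qed
    moreover have "(1 - l) * (X * D) \<le> 1 * (X * (s * (S / 12)))"
      using D X l_le pos nonnegs by (intro mult_mono) auto
    moreover have "D\<^sup>2 \<le> S\<^sup>2 / 576"
    proof -
      have "D\<^sup>2 \<le> (s * (S / 12))\<^sup>2" using D nonnegs by (intro power_mono) auto
      also have "\<dots> = l * (S\<^sup>2 / 144)" by (simp add: power_mult_distrib sq power_divide)
      also have "\<dots> \<le> 1 / 4 * (S\<^sup>2 / 144)" using l_le by (intro mult_right_mono) auto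
      finally show ?thesis by simp
    qed
    moreover have "1 * (X * (s * (S / 12))) = s * X * S / 12" by simp
    ultimately show ?thesis by argo
  qed
  have track: "(1 - 2 * a * n + (a * L)\<^sup>2) * U\<^sup>2 + 2 * U * W + W\<^sup>2
      \<le> U\<^sup>2 - 63 / 32 * u\<^sup>2 + 2 * (u * w) + w\<^sup>2 / 32"
  proof -
    have "a * (32 * L\<^sup>2 * a) \<le> a * n" using an_le(2) pos by (intro mult_left_mono) auto
    then have "(1 - 2 * a * n + (a * L)\<^sup>2) * U\<^sup>2 \<le> (1 - 63 / 32 * (a * n)) * U\<^sup>2"
      by (intro mult_right_mono) (simp_all add: power2_eq_square mult_ac)
    also have "\<dots> = U\<^sup>2 - 63 / 32 * u\<^sup>2" by (simp add: u_def power_mult_distrib sq algebra_simps)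
    finally have "(1 - 2 * a * n + (a * L)\<^sup>2) * U\<^sup>2 \<le> U\<^sup>2 - 63 / 32 * u\<^sup>2" .
    moreover have "U * W \<le> U * (p * w)" using W nonneg by (intro mult_left_mono) auto
    moreover have "W\<^sup>2 \<le> w\<^sup>2 / 32"
    proof -
      have "W\<^sup>2 \<le> (p * w)\<^sup>2" using W nonnegs by (intro power_mono) auto
      also have "\<dots> = (a * n) * w\<^sup>2" by (simp add: power_mult_distrib sq)
      also have "\<dots> \<le> 1 / 32 * w\<^sup>2" using an_le by (intro mult_right_mono) auto
      finally show ?thesis by simp
    qed
    moreover have "U * (p * w) = u * w" by (simp add: u_def)
    ultimately show ?thesis by argo
  qed
  have slow: "(1 - 2 * m * b) * V\<^sup>2 + 2 * b * V * (Q + L * U) + N\<^sup>2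
      \<le> V\<^sup>2 - 2 * v\<^sup>2 + q * v / 32 + 2 / 5 * (u * v) + z\<^sup>2"
  proof -
    have "64 * b * (V * Q) \<le> s * r * (V * Q)" "5 * (L * b) * (V * U) \<le> p * r * (V * U)"
      using coef nonneg by (auto intro!: mult_right_mono)
    then have "64 * (b * V * Q) \<le> q * v" "5 * (b * V * (L * U)) \<le> u * v"
      by (simp_all add: v_def q_def u_def mult_ac)
    moreover have "2 * b * V * (Q + L * U) = 2 * (b * V * Q) + 2 * (b * V * (L * U))" by (simp add: algebra_simps)
    moreover have "N\<^sup>2 \<le> z\<^sup>2" using N nonnegs by (intro power_mono) auto
    moreover have "(1 - 2 * m * b) * V\<^sup>2 = V\<^sup>2 - 2 * v\<^sup>2"
      by (simp add: v_def power_mult_distrib sq algebra_simps)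
    ultimately show ?thesis by argo
  qed
  \<comment> \<open>This is the price of the factor \<open>1 - m * b\<close>. After paying it, every
    scaled square still has at least one unit of decay left: \<open>7 / 4 - 1 / 768\<close> for
    \<open>e\<close> and \<open>q\<close>, \<open>63 / 32 - 1 / 32\<close> for \<open>u\<close>, and
    exactly \<open>2 - 1\<close> for \<open>v\<close>.\<close>
  have res: "m * b * E\<^sup>2 \<le> e\<^sup>2 / 768" "m * b * Q\<^sup>2 \<le> q\<^sup>2 / 768" "m * b * U\<^sup>2 \<le> u\<^sup>2 / 32" "m * b * V\<^sup>2 = v\<^sup>2"
    using mb_le mult_right_mono[of "768 * (m * b)" l "E\<^sup>2"] mult_right_mono[of "768 * (m * b)" l "Q\<^sup>2"]
      mult_right_mono[of "32 * (m * b)" "a * n" "U\<^sup>2"]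
    by (auto simp: e_def q_def u_def v_def power_mult_distrib sq)
  have young: "2 * (\<rho> * \<sigma>) \<le> \<rho>\<^sup>2 + \<sigma>\<^sup>2" for \<rho> \<sigma> :: real
    using sum_squares_bound[of \<rho> \<sigma>] by simp
  have four: "(c1 + c2 + c3 + c4)\<^sup>2 \<le> 4 * (c1\<^sup>2 + c2\<^sup>2 + c3\<^sup>2 + c4\<^sup>2)" for c1 c2 c3 c4 :: real
  proof -
    have "(c1 + c2 + c3 + c4)\<^sup>2 = c1\<^sup>2 + c2\<^sup>2 + c3\<^sup>2 + c4\<^sup>2 + 2 * (c1 * c2) + 2 * (c1 * c3)
        + 2 * (c1 * c4) + 2 * (c2 * c3) + 2 * (c2 * c4) + 2 * (c3 * c4)"
      by (simp add: power2_eq_square algebra_simps)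
    then show ?thesis
      using young[of c1 c2] young[of c1 c3] young[of c1 c4] young[of c2 c3] young[of c2 c4] young[of c3 c4]
      by argo
  qed
  \<comment> \<open>Diagonal dominance: the remaining unit of decay in each variable absorbs all
    couplings. The heaviest is \<open>u * v\<close>, with 2/5 hidden in \<open>2 * (u * w)\<close>
    and 2/5 explicit; Young's inequality splits it evenly between the two squares.\<close>
  have core: "(e + q) * S / 6 + S\<^sup>2 / 288 + 2 * (u * w) + w\<^sup>2 / 32 + q * v / 32 + 2 / 5 * (u * v) + z\<^sup>2
     \<le> e\<^sup>2 + q\<^sup>2 + u\<^sup>2 + v\<^sup>2"
  proof -
    have "(e + q) * S = e\<^sup>2 + q\<^sup>2 + 2 * (e * q) + e * u + e * v + q * u + q * v"
      unfolding S_def by (simp add: power2_eq_square algebra_simps)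
    moreover have "u * w = e * u / 12 + q * u / 32 + u\<^sup>2 / 32 + u * v / 5"
      unfolding w_def by (simp add: power2_eq_square algebra_simps)
    moreover have "S\<^sup>2 \<le> 4 * (e\<^sup>2 + q\<^sup>2 + u\<^sup>2 + v\<^sup>2)" unfolding S_def by (rule four)
    moreover have "w\<^sup>2 \<le> 4 * (e\<^sup>2 / 144 + q\<^sup>2 / 1024 + u\<^sup>2 / 1024 + v\<^sup>2 / 25)"
      using four[of "e / 12" "q / 32" "u / 32" "v / 5"] unfolding w_def by (simp add: power_divide)
    moreover have "z\<^sup>2 \<le> 4 * (q\<^sup>2 / 4096 + u\<^sup>2 / 256 + v\<^sup>2 / 1024)"
      using four[of "q / 64" "u / 16" "v / 32" 0] unfolding z_def by (simp add: power_divide)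
    ultimately show ?thesis
      using young[of e q] young[of e u] young[of e v] young[of q u] young[of q v] young[of u v]
        zero_le_power2[of e] zero_le_power2[of q] zero_le_power2[of u] zero_le_power2[of v]
      by argo
  qed
  have "e * S / 6 + q * S / 6 = (e + q) * S / 6" by (simp add: algebra_simps)
  moreover have "(1 - m * b) * (E\<^sup>2 + Q\<^sup>2 + U\<^sup>2 + V\<^sup>2) =
     E\<^sup>2 + Q\<^sup>2 + U\<^sup>2 + V\<^sup>2 - m * b * E\<^sup>2 - m * b * Q\<^sup>2 - m * b * U\<^sup>2 - m * b * V\<^sup>2"
    by (simp add: algebra_simps)
  ultimately show ?thesis
    using fast[OF nonneg(1)] fast[OF nonneg(2)] track slow res core
      zero_le_power2[of e] zero_le_power2[of q] zero_le_power2[of u] zero_le_power2[of v]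
    unfolding e_def[symmetric] q_def[symmetric] by linarith
qed

end

section \<open>The noiseless step\<close>

lemma norm_diff_scaleR_squared:
  fixes p q :: "'b::real_inner"
  shows "(norm (p - a *\<^sub>R q))\<^sup>2 = (norm p)\<^sup>2 - 2 * a * (p \<bullet> q) + (a * norm q)\<^sup>2"
  unfolding power_mult_distrib power2_norm_eq_inner
  by (simp add: inner_diff inner_commute algebra_simps power2_eq_square)

locale two_time_scale =
  fixes F G :: "'b::euclidean_space \<Rightarrow> 'b \<Rightarrow> 'b"
    and H :: "'b \<Rightarrow> 'b"
    and xstar ystar :: 'b
    and L n m :: real
  assumes root: "F xstar ystar = 0" "G xstar ystar = 0"
    and H_root: "F (H v) v = 0"
    and L_pos: "L > 0"
    and H_lip: "norm (H v - H w) \<le> L * norm (v - w)"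
    and F_lip: "norm (F u v - F w z) \<le> L * (norm (u - w) + norm (v - z))"
    and G_lip: "norm (G u v - G w z) \<le> L * (norm (u - w) + norm (v - z))"
    and m: "0 < m" "m \<le> n"
    and F_mono: "(u - w) \<bullet> (F u v - F w v) \<ge> n * (norm (u - w))\<^sup>2"
    and G_mono: "(v - ystar) \<bullet> G (H v) v \<ge> m * (norm (v - ystar))\<^sup>2"
begin

text \<open>Testing monotonicity and Lipschitz continuity of \<open>F\<close> on one unit vector;
  such a vector exists because the dimension is at least one.\<close>

lemma n_le_L: "n \<le> L"
proof -
  obtain e :: 'b where e: "norm e = 1" using norm_Basis[OF SOME_Basis] by blast
  have "n \<le> e \<bullet> (F e 0 - F 0 0)" using F_mono[of e 0 0] e by simp
  also have "\<dots> \<le> norm e * norm (F e 0 - F 0 0)" by (rule norm_cauchy_schwarz)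
  also have "\<dots> \<le> L" using F_lip[of e 0 0 0] e by simp
  finally show ?thesis .
qed

text \<open>Strong monotonicity makes the root of \<open>F\<close> in its first argument unique.
  Hence \<open>G (H ystar) ystar = 0\<close>, which the growth bound for \<open>G\<close> rests
  on.\<close>

lemma H_ystar: "H ystar = xstar"
proof -
  have "n * (norm (H ystar - xstar))\<^sup>2 \<le> 0"
    using F_mono[of "H ystar" xstar ystar] by (simp add: H_root root)
  then show ?thesis using m by (simp add: mult_le_0_iff)
qed

lemma norm_F_le: "norm (F u v) \<le> L * norm (u - H v)"
  using F_lip[of u v "H v" v] by (simp add: H_root)

lemma norm_G_diff_le: "norm (G u v - G (H v) v) \<le> L * norm (u - H v)"
  using G_lip[of u v "H v" v] by simp

lemma norm_G_le: "norm (G u v) \<le> L * norm (u - H v) + L * (1 + L) * norm (v - ystar)"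
proof -
  have "norm (G (H v) v) \<le> L * (norm (H v - H ystar) + norm (v - ystar))"
    using G_lip[of "H v" v "H ystar" ystar] by (simp add: H_ystar root)
  also have "\<dots> \<le> L * (L * norm (v - ystar) + norm (v - ystar))"
    using L_pos H_lip by (intro mult_left_mono) auto
  finally have "norm (G (H v) v) \<le> L * (1 + L) * norm (v - ystar)" by (simp add: algebra_simps)
  then show ?thesis
    using norm_G_diff_le[of u v] norm_triangle_ineq[of "G u v - G (H v) v" "G (H v) v"] by simp
qed

text \<open>Without noise, \<open>f\<close> and \<open>g\<close> would be updated to the first two arguments on the left. Since
  \<open>x'\<close> and \<open>y'\<close> do not involve the current noise, the latter only adds terms that are linear or
  quadratic in it.\<close>

lemma lyapunov_descent:
  fixes f g x y :: 'b
  assumes "step_sizes L n m a b l"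
  defines "x' \<equiv> x - a *\<^sub>R f" and "y' \<equiv> y - b *\<^sub>R g"
  shows "lyapunov F G H ystar ((1 - l) *\<^sub>R f + l *\<^sub>R F x y) ((1 - l) *\<^sub>R g + l *\<^sub>R G x y) x' y'
    \<le> (1 - m * b) * lyapunov F G H ystar f g x y"
proof -
  interpret step_sizes L n m a b l by fact
  define E Q U V where "E = norm (f - F x y)" and "Q = norm (g - G x y)"
    and "U = norm (x - H y)" and "V = norm (y - ystar)"
  define N where "N = b * (Q + L * U + L * (1 + L) * V)"
  define D where "D = L * (a * (E + L * U) + N)"
  define W where "W = a * E + L * N"
  have nonneg: "0 \<le> E" "0 \<le> Q" "0 \<le> U" "0 \<le> V"
    by (simp_all add: E_def Q_def U_def V_def)
  have f: "norm f \<le> E + L * U"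
    using norm_triangle_ineq[of "f - F x y" "F x y"] norm_F_le[of x y] by (simp add: E_def U_def)
  have "norm g \<le> Q + L * U + L * (1 + L) * V"
    using norm_triangle_ineq[of "g - G x y" "G x y"] norm_G_le[of x y]
    by (simp add: Q_def U_def V_def)
  then have g: "b * norm g \<le> N"
    unfolding N_def using pos by (intro mult_left_mono) auto
  have shift: "L * (norm (x - x') + norm (y - y')) \<le> D"
    unfolding D_def x'_def y'_def using f g pos L_pos
    by (auto intro!: mult_left_mono add_mono)
  have l: "0 \<le> 1 - l" using l_le by simp
  \<comment> \<open>The old tracking error shrinks by \<open>1 - l\<close>, and the target moves
    from \<open>T x y\<close> to \<open>T x' y'\<close>; \<open>T\<close> will be \<open>F\<close>
    or \<open>G\<close>.\<close>
  have filter: "(norm ((1 - l) *\<^sub>R w + l *\<^sub>R T x y - T x' y'))\<^sup>2 \<le> ((1 - l) * norm (w - T x y) + D)\<^sup>2"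
    if "norm (T x y - T x' y') \<le> L * (norm (x - x') + norm (y - y'))" for w :: 'b and T
  proof (rule power_mono)
    have "(1 - l) *\<^sub>R w + l *\<^sub>R T x y - T x' y' = (1 - l) *\<^sub>R (w - T x y) + (T x y - T x' y')"
      by (simp add: algebra_simps)
    also have "norm \<dots> \<le> (1 - l) * norm (w - T x y) + norm (T x y - T x' y')"
      using l by (intro norm_triangle_le) simp
    finally show "norm ((1 - l) *\<^sub>R w + l *\<^sub>R T x y - T x' y') \<le> (1 - l) * norm (w - T x y) + D"
      using that shift by linarith
  qed simp
  have fast: "(norm (x' - H y'))\<^sup>2 \<le> (1 - 2 * a * n + (a * L)\<^sup>2) * U\<^sup>2 + 2 * U * W + W\<^sup>2"
  proof -
    \<comment> \<open>\<open>c\<close> is the residual after an exact step along \<open>F\<close>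
      with \<open>y\<close> frozen, which strong monotonicity contracts. \<open>d\<close> collects
      the motion of \<open>H y\<close> and the error of \<open>f\<close> as an estimate of
      \<open>F x y\<close>.\<close>
    define c where "c = x - H y - a *\<^sub>R F x y"
    define d where "d = H y - H y' - a *\<^sub>R (f - F x y)"
    have c2: "(norm c)\<^sup>2 \<le> (1 - 2 * a * n + (a * L)\<^sup>2) * U\<^sup>2"
    proof -
      have "(norm c)\<^sup>2 = U\<^sup>2 - 2 * a * ((x - H y) \<bullet> F x y) + (a * norm (F x y))\<^sup>2"
        unfolding c_def U_def by (rule norm_diff_scaleR_squared)
      moreover have "a * (n * U\<^sup>2) \<le> a * ((x - H y) \<bullet> F x y)"
        using F_mono[of x "H y" y] pos by (simp add: H_root U_def)
      moreover have "(a * norm (F x y))\<^sup>2 \<le> (a * (L * U))\<^sup>2"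
        using norm_F_le[of x y] pos by (intro power_mono mult_left_mono) (auto simp: U_def)
      ultimately show ?thesis by (simp add: algebra_simps power_mult_distrib)
    qed
    have "a * (L\<^sup>2 * a) \<le> a * n"
      using an_le(2) pos n_pos by (intro mult_left_mono) (auto simp: mult_ac)
    moreover have "0 \<le> a * n" using pos n_pos by simp
    ultimately have "1 - 2 * a * n + (a * L)\<^sup>2 \<le> 1" by (simp add: power2_eq_square mult_ac)
    from mult_right_mono[OF this, of "U\<^sup>2"] have "(norm c)\<^sup>2 \<le> U\<^sup>2" using c2 by simp
    then have c: "norm c \<le> U" using nonneg by (simp add: power2_le_iff_abs_le)
    have "norm (H y - H y') \<le> L * N"
    proof -
      have "norm (H y - H y') \<le> L * norm (y - y')" by (rule H_lip)
      also have "\<dots> \<le> L * N" using g pos L_pos by (simp add: y'_def)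
      finally show ?thesis .
    qed
    moreover have "norm (a *\<^sub>R (f - F x y)) = a * E" using pos by (simp add: E_def)
    ultimately have d: "norm d \<le> W"
      unfolding d_def W_def using norm_triangle_ineq4[of "H y - H y'" "a *\<^sub>R (f - F x y)"] by linarith
    have "c \<bullet> d \<le> norm c * norm d" by (rule norm_cauchy_schwarz)
    also have "\<dots> \<le> U * W" using c d nonneg by (intro mult_mono) auto
    finally have "c \<bullet> d \<le> U * W" .
    moreover have "(norm d)\<^sup>2 \<le> W\<^sup>2" using d by (intro power_mono) auto
    moreover have "x' - H y' = c + d" by (simp add: x'_def c_def d_def algebra_simps)
    then have "(norm (x' - H y'))\<^sup>2 = (norm c)\<^sup>2 + 2 * (c \<bullet> d) + (norm d)\<^sup>2"
      by (simp add: power2_norm_eq_inner inner_simps inner_commute)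
    ultimately show ?thesis using c2 by (simp add: mult.assoc)
  qed
  have slow: "(norm (y' - ystar))\<^sup>2 \<le> (1 - 2 * m * b) * V\<^sup>2 + 2 * b * V * (Q + L * U) + N\<^sup>2"
  proof -
    \<comment> \<open>The direction \<open>g\<close> is split as \<open>?r + G (H y) y\<close>: only
      \<open>G (H y) y\<close> has a sign against \<open>?v\<close>, and \<open>?r\<close> is
      controlled by the residuals of \<open>g\<close> and \<open>x\<close>.\<close>
    let ?v = "y - ystar" and ?r = "g - G x y + (G x y - G (H y) y)"
    have "- (?v \<bullet> ?r) \<le> norm ?v * norm ?r"
      using Cauchy_Schwarz_ineq2[of ?v ?r] by linarith
    also have "\<dots> \<le> V * (Q + L * U)"
      using norm_triangle_ineq[of "g - G x y" "G x y - G (H y) y"] norm_G_diff_le[of x y] nonneg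
      by (intro mult_mono) (auto simp: V_def Q_def U_def)
    finally have "- (?v \<bullet> ?r) \<le> V * (Q + L * U)" .
    moreover have "?v \<bullet> g = ?v \<bullet> ?r + ?v \<bullet> G (H y) y" by (simp add: inner_simps)
    ultimately have "- (?v \<bullet> g) \<le> V * (Q + L * U) - m * V\<^sup>2"
      using G_mono[of y] unfolding V_def by linarith
    then have "2 * b * (- (?v \<bullet> g)) \<le> 2 * b * (V * (Q + L * U) - m * V\<^sup>2)"
      using pos by (intro mult_left_mono) auto
    moreover have "(norm (y' - ystar))\<^sup>2 = V\<^sup>2 - 2 * b * (?v \<bullet> g) + (b * norm g)\<^sup>2"
      using norm_diff_scaleR_squared[of ?v b g] by (simp add: y'_def V_def algebra_simps)
    moreover have "(b * norm g)\<^sup>2 \<le> N\<^sup>2" using g pos by (intro power_mono) auto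
    ultimately show ?thesis by (simp add: algebra_simps)
  qed
  show ?thesis
    using quadratic_form_le[OF nonneg] filter[OF F_lip, of f] filter[OF G_lip, of g] fast slow
    unfolding lyapunov_def E_def[symmetric] Q_def[symmetric] U_def[symmetric] V_def[symmetric]
      N_def[symmetric] D_def[symmetric] W_def[symmetric]
    by linarith
qed

end

section \<open>Square-integrable iterates and orthogonal noise\<close>

text \<open>This class is closed under the recursion and makes every inner product of two members
  integrable. Integrability has to be tracked because linearity and monotonicity of the Bochner
  integral depend on it.\<close>

definition sq_integrable :: "'w measure \<Rightarrow> ('w \<Rightarrow> 'b::euclidean_space) \<Rightarrow> bool" where
  "sq_integrable M X \<longleftrightarrow> X \<in> borel_measurable M \<and> integrable M (\<lambda>\<omega>. (norm (X \<omega>))\<^sup>2)"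

lemma sq_integrableD:
  assumes "sq_integrable M X"
  shows "X \<in> borel_measurable M" "integrable M (\<lambda>\<omega>. (norm (X \<omega>))\<^sup>2)"
  using assms by (auto simp: sq_integrable_def)

text \<open>Agreement on \<open>space M\<close> is all that is available for the iterates, since
  their recursion is assumed only there.\<close>

lemma sq_integrable_cong:
  assumes "\<And>\<omega>. \<omega> \<in> space M \<Longrightarrow> X \<omega> = Y \<omega>"
  shows "sq_integrable M X \<longleftrightarrow> sq_integrable M Y"
proof -
  have "X \<in> borel_measurable M \<longleftrightarrow> Y \<in> borel_measurable M"
    by (rule measurable_cong) (rule assms)
  moreover have "integrable M (\<lambda>\<omega>. (norm (X \<omega>))\<^sup>2) \<longleftrightarrow> integrable M (\<lambda>\<omega>. (norm (Y \<omega>))\<^sup>2)"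
    by (rule Bochner_Integration.integrable_cong[OF refl]) (simp add: assms)
  ultimately show ?thesis by (simp add: sq_integrable_def)
qed

lemma sq_integrable_bound:
  assumes X: "X \<in> borel_measurable M"
    and Y: "sq_integrable M Y" and Z: "sq_integrable M Z"
    and le: "\<And>\<omega>. norm (X \<omega>) \<le> norm (Y \<omega>) + norm (Z \<omega>)"
  shows "sq_integrable M X"
  unfolding sq_integrable_def
proof (rule conjI[OF X], rule Bochner_Integration.integrable_bound)
  show "integrable M (\<lambda>\<omega>. 2 * (norm (Y \<omega>))\<^sup>2 + 2 * (norm (Z \<omega>))\<^sup>2)"
    using sq_integrableD(2)[OF Y] sq_integrableD(2)[OF Z] by auto
  show "(\<lambda>\<omega>. (norm (X \<omega>))\<^sup>2) \<in> borel_measurable M" using X by measurable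
  have "(norm (X \<omega>))\<^sup>2 \<le> 2 * (norm (Y \<omega>))\<^sup>2 + 2 * (norm (Z \<omega>))\<^sup>2" for \<omega>
  proof -
    have "(norm (X \<omega>))\<^sup>2 \<le> (norm (Y \<omega>) + norm (Z \<omega>))\<^sup>2"
      using le[of \<omega>] by (intro power_mono) auto
    then show ?thesis
      using sum_squares_bound[of "norm (Y \<omega>)" "norm (Z \<omega>)"] by (simp add: power2_sum)
  qed
  then show "AE \<omega> in M. norm ((norm (X \<omega>))\<^sup>2) \<le> norm (2 * (norm (Y \<omega>))\<^sup>2 + 2 * (norm (Z \<omega>))\<^sup>2)"
    by simp
qed

lemma sq_integrable_add:
  assumes "sq_integrable M X" "sq_integrable M Y"
  shows "sq_integrable M (\<lambda>\<omega>. X \<omega> + Y \<omega>)"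
  by (rule sq_integrable_bound[OF _ assms])
    (use assms in \<open>auto simp: sq_integrable_def norm_triangle_ineq\<close>)

lemma sq_integrable_diff:
  assumes "sq_integrable M X" "sq_integrable M Y"
  shows "sq_integrable M (\<lambda>\<omega>. X \<omega> - Y \<omega>)"
  by (rule sq_integrable_bound[OF _ assms])
    (use assms in \<open>auto simp: sq_integrable_def norm_triangle_ineq4\<close>)

lemma sq_integrable_scaleR: "sq_integrable M X \<Longrightarrow> sq_integrable M (\<lambda>\<omega>. c *\<^sub>R X \<omega>)"
  by (auto simp: sq_integrable_def power_mult_distrib)

lemma (in finite_measure) sq_integrable_const: "sq_integrable M (\<lambda>\<omega>. c)"
  by (auto simp: sq_integrable_def)

lemma integrable_inner_sq:
  assumes "sq_integrable M X" "sq_integrable M Y"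
  shows "integrable M (\<lambda>\<omega>. X \<omega> \<bullet> Y \<omega>)"
proof (rule Bochner_Integration.integrable_bound)
  show "integrable M (\<lambda>\<omega>. (norm (X \<omega>))\<^sup>2 + (norm (Y \<omega>))\<^sup>2)"
    using assms by (auto dest: sq_integrableD)
  show "(\<lambda>\<omega>. X \<omega> \<bullet> Y \<omega>) \<in> borel_measurable M"
    using assms by (intro borel_measurable_inner sq_integrableD(1))
  have "\<bar>X \<omega> \<bullet> Y \<omega>\<bar> \<le> (norm (X \<omega>))\<^sup>2 + (norm (Y \<omega>))\<^sup>2" for \<omega>
    using Cauchy_Schwarz_ineq2[of "X \<omega>" "Y \<omega>"] sum_squares_bound[of "norm (X \<omega>)" "norm (Y \<omega>)"]
      mult_nonneg_nonneg[OF norm_ge_zero[of "X \<omega>"] norm_ge_zero[of "Y \<omega>"]] by linarith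
  then show "AE \<omega> in M. norm (X \<omega> \<bullet> Y \<omega>) \<le> norm ((norm (X \<omega>))\<^sup>2 + (norm (Y \<omega>))\<^sup>2)"
    by simp
qed

text \<open>The measure is arbitrary, so the result serves both for \<open>M\<close> and for the
  sigma-algebras of the noise history.\<close>

lemma borel_measurable_lipschitz2:
  fixes T :: "'b::euclidean_space \<Rightarrow> 'b \<Rightarrow> 'c::euclidean_space"
  assumes L: "0 \<le> L"
    and lip: "\<And>u v w z. norm (T u v - T w z) \<le> L * (norm (u - w) + norm (v - z))"
    and X: "X \<in> borel_measurable M" and Y: "Y \<in> borel_measurable M"
  shows "(\<lambda>\<omega>. T (X \<omega>) (Y \<omega>)) \<in> borel_measurable M"
proof (rule borel_measurable_continuous_Pair[OF X Y])
  have "(2 * L)-lipschitz_on UNIV (\<lambda>p. T (fst p) (snd p))"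
  proof (rule lipschitz_onI)
    fix p q :: "'b \<times> 'b"
    have "dist (T (fst p) (snd p)) (T (fst q) (snd q)) \<le> L * (dist (fst p) (fst q) + dist (snd p) (snd q))"
      unfolding dist_norm by (rule lip)
    also have "\<dots> \<le> L * (dist p q + dist p q)"
      using L by (intro mult_left_mono add_mono dist_fst_le dist_snd_le)
    finally show "dist (T (fst p) (snd p)) (T (fst q) (snd q)) \<le> 2 * L * dist p q" by simp
  qed (use L in simp)
  then show "continuous_on UNIV (\<lambda>p. T (fst p) (snd p))" by (rule lipschitz_on_continuous_on)
qed

text \<open>A zero of \<open>T\<close> turns Lipschitz continuity into linear growth around
  \<open>u0\<close> and \<open>v0\<close>; shifting by these constants preserves square
  integrability because the measure is finite.\<close>

lemma (in finite_measure) sq_integrable_lipschitz2: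
  fixes T :: "'b::euclidean_space \<Rightarrow> 'b \<Rightarrow> 'b"
  assumes L: "0 \<le> L"
    and lip: "\<And>u v w z. norm (T u v - T w z) \<le> L * (norm (u - w) + norm (v - z))"
    and X: "sq_integrable M X" and Y: "sq_integrable M Y" and root: "T u0 v0 = 0"
  shows "sq_integrable M (\<lambda>\<omega>. T (X \<omega>) (Y \<omega>))"
proof (rule sq_integrable_bound)
  show "(\<lambda>\<omega>. T (X \<omega>) (Y \<omega>)) \<in> borel_measurable M"
    using X Y by (intro borel_measurable_lipschitz2[OF L lip]) (auto dest: sq_integrableD)
  show "sq_integrable M (\<lambda>\<omega>. L *\<^sub>R (X \<omega> - u0))" "sq_integrable M (\<lambda>\<omega>. L *\<^sub>R (Y \<omega> - v0))"
    using X Y by (intro sq_integrable_scaleR sq_integrable_diff sq_integrable_const; simp)+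
  show "norm (T (X \<omega>) (Y \<omega>)) \<le> norm (L *\<^sub>R (X \<omega> - u0)) + norm (L *\<^sub>R (Y \<omega> - v0))" for \<omega>
    using lip[of "X \<omega>" "Y \<omega>" u0 v0] root L
    by (simp add: distrib_left flip: scaleR_diff_right)
qed

section \<open>Generated sigma-algebras and orthogonality to the past\<close>

lemma space_generated_sigma: "space (generated_sigma M \<X>) = space M"
  by (simp add: generated_sigma_def space_measure_of_conv)

lemma sets_generated_sigma:
  "sets (generated_sigma M \<X>) =
    sigma_sets (space M) (\<Union>X\<in>\<X>. {X -` A \<inter> space M | A. A \<in> sets borel})"
  unfolding generated_sigma_def by (rule sets_measure_of) auto

lemma measurable_generated_sigma:
  assumes "X \<in> \<X>"
  shows "X \<in> borel_measurable (generated_sigma M \<X>)"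
  by (rule measurableI) (use assms in \<open>auto simp: space_generated_sigma sets_generated_sigma\<close>)

lemma subalgebra_generated_sigma:
  assumes "\<X> \<subseteq> borel_measurable N" "space N = space M"
  shows "subalgebra N (generated_sigma M \<X>)"
proof -
  have "X -` A \<inter> space M \<in> sets N" if "X \<in> \<X>" "A \<in> sets borel" for X A
    using measurable_sets[of X N borel A] that assms by auto
  then have "(\<Union>X\<in>\<X>. {X -` A \<inter> space M | A. A \<in> sets borel}) \<subseteq> sets N" by blast
  from sets.sigma_sets_subset[OF this] show ?thesis
    by (simp add: subalgebra_def space_generated_sigma sets_generated_sigma assms(2))
qed

lemma subalgebra_noise_history_Suc:
  "subalgebra (noise_history M I \<xi> \<psi> (Suc k)) (noise_history M I \<xi> \<psi> k)"
  unfolding noise_history_def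
proof (rule subalgebra_generated_sigma)
  have "I \<union> (\<Union>j<k. {\<xi> j, \<psi> j}) \<subseteq> I \<union> (\<Union>j<Suc k. {\<xi> j, \<psi> j})"
    using less_SucI by blast
  then show "I \<union> (\<Union>j<k. {\<xi> j, \<psi> j}) \<subseteq>
      borel_measurable (generated_sigma M (I \<union> (\<Union>j<Suc k. {\<xi> j, \<psi> j})))"
    using measurable_generated_sigma by blast
qed (rule space_generated_sigma)

text \<open>\<open>Z\<close> is known given \<open>Q\<close>, so in each coordinate it can be
  multiplied by the conditional expectation of \<open>X\<close> in place of \<open>X\<close> without
  changing the integral. Square integrability of both factors makes the products integrable.\<close>

lemma (in prob_space) expectation_inner_eq_0:
  fixes X Z :: "'a \<Rightarrow> real ^ 'n"
  assumes Q: "subalgebra M Q" and Z: "Z \<in> borel_measurable Q"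
    and sq: "sq_integrable M Z" "sq_integrable M X"
    and cond: "AE \<omega> in M. vec_cond_exp M Q X \<omega> = 0"
  shows "expectation (\<lambda>\<omega>. Z \<omega> \<bullet> X \<omega>) = 0"
proof -
  interpret finite_measure_subalgebra M Q by standard (rule Q)
  have nth: "(\<lambda>\<omega>. Y \<omega> $ i) \<in> borel_measurable N" if "Y \<in> borel_measurable N"
    for Y :: "'a \<Rightarrow> real ^ 'n" and N i
    using that unfolding cart_eq_inner_axis by simp
  have comp: "sq_integrable M (\<lambda>\<omega>. Y \<omega> $ i)" if "sq_integrable M Y" for Y :: "'a \<Rightarrow> real ^ 'n" and i
    by (rule sq_integrable_bound[OF _ that sq_integrable_const[of 0]])
      (use that in \<open>auto simp: component_le_norm_cart intro: nth dest: sq_integrableD(1)\<close>)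
  have int: "integrable M (\<lambda>\<omega>. Z \<omega> $ i * X \<omega> $ i)" for i
    using integrable_inner_sq[OF comp[OF sq(1)] comp[OF sq(2)], of i i] by simp
  have "expectation (\<lambda>\<omega>. Z \<omega> $ i * X \<omega> $ i) = 0" for i
  proof -
    have "expectation (\<lambda>\<omega>. Z \<omega> $ i * X \<omega> $ i) =
        expectation (\<lambda>\<omega>. Z \<omega> $ i * real_cond_exp M Q (\<lambda>\<omega>'. X \<omega>' $ i) \<omega>)"
      using Z sq(2)
      by (intro real_cond_exp_intg(2)[symmetric] int) (auto intro!: nth borel_measurable_times dest: sq_integrableD(1))
    also have "\<dots> = expectation (\<lambda>\<omega>. 0)"
    proof (rule integral_cong_AE)
      show "AE \<omega> in M. Z \<omega> $ i * real_cond_exp M Q (\<lambda>\<omega>'. X \<omega>' $ i) \<omega> = 0"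
        using cond by eventually_elim (simp add: vec_cond_exp_def vec_eq_iff)
    qed (use sq(1) in \<open>auto intro!: nth borel_measurable_times dest: sq_integrableD(1)\<close>)
    finally show ?thesis by simp
  qed
  then show ?thesis
    using int by (simp add: inner_vec_def)
qed

lemma (in two_time_scale) integrable_lyapunov:
  assumes "prob_space M"
    and sq: "sq_integrable M f" "sq_integrable M g" "sq_integrable M x" "sq_integrable M y"
  shows "integrable M (\<lambda>\<omega>. lyapunov F G H ystar (f \<omega>) (g \<omega>) (x \<omega>) (y \<omega>))"
proof -
  interpret prob_space M by fact
  have "sq_integrable M (\<lambda>\<omega>. H (y \<omega>) - H ystar)"
  \<comment> \<open>\<open>H\<close> is treated as a map of two arguments with a dummy first one;
    subtracting \<open>H ystar\<close> supplies the required zero.\<close>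
  proof (rule sq_integrable_lipschitz2[where T = "\<lambda>u v. H v - H ystar"])
    show "norm ((H v - H ystar) - (H z - H ystar)) \<le> L * (norm (u - w) + norm (v - z))" for u v w z
      using H_lip[of v z] mult_nonneg_nonneg[OF less_imp_le[OF L_pos] norm_ge_zero[of "u - w"]]
      by (simp add: distrib_left)
  qed (use sq L_pos in auto)
  from sq_integrable_add[OF this sq_integrable_const[of "H ystar"]]
  have H: "sq_integrable M (\<lambda>\<omega>. H (y \<omega>))" by simp
  have "sq_integrable M (\<lambda>\<omega>. F (x \<omega>) (y \<omega>))" "sq_integrable M (\<lambda>\<omega>. G (x \<omega>) (y \<omega>))"
    by (rule sq_integrable_lipschitz2[OF less_imp_le[OF L_pos] F_lip sq(3,4) root(1)],
        rule sq_integrable_lipschitz2[OF less_imp_le[OF L_pos] G_lip sq(3,4) root(2)])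
  with sq H have "sq_integrable M (\<lambda>\<omega>. f \<omega> - F (x \<omega>) (y \<omega>))"
    "sq_integrable M (\<lambda>\<omega>. g \<omega> - G (x \<omega>) (y \<omega>))"
    "sq_integrable M (\<lambda>\<omega>. x \<omega> - H (y \<omega>))" "sq_integrable M (\<lambda>\<omega>. y \<omega> - ystar)"
    by (auto intro: sq_integrable_diff sq_integrable_const)
  then show ?thesis
    unfolding lyapunov_def by (intro Bochner_Integration.integrable_add sq_integrableD(2))
qed

section \<open>The expected decrease in one noisy step\<close>

theorem theorem1:
  fixes M :: "'w measure"
    and F G :: "real ^ 'n \<Rightarrow> real ^ 'n \<Rightarrow> real ^ 'n"
    and H :: "real ^ 'n \<Rightarrow> real ^ 'n"
    and xstar ystar :: "real ^ 'n"
    and L \<mu>\<^sub>F \<mu>\<^sub>G \<Gamma>\<^sub>1\<^sub>1 \<Gamma>\<^sub>2\<^sub>2 C\<^sub>l C\<^sub>g C\<^sub>a C\<^sub>b h :: real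
    and lam \<gamma> \<alpha> \<beta> :: "nat \<Rightarrow> real"
    and \<xi> \<psi> f g x y :: "nat \<Rightarrow> 'w \<Rightarrow> real ^ 'n"
    and Q :: "nat \<Rightarrow> 'w measure"
  defines "Q \<equiv> noise_history M {x 0, y 0, f 0, g 0} \<xi> \<psi>"
  assumes prob: "prob_space M"
    and root: "F xstar ystar = 0" "G xstar ystar = 0"
    and H_root: "\<And>v. F (H v) v = 0"
    and L_pos: "L > 0"
    and H_lip: "\<And>v w. norm (H v - H w) \<le> L * norm (v - w)"
    and F_lip: "\<And>u v w z. norm (F u v - F w z) \<le> L * (norm (u - w) + norm (v - z))"
    and G_lip: "\<And>u v w z. norm (G u v - G w z) \<le> L * (norm (u - w) + norm (v - z))"
    and \<mu>_bounds: "0 < \<mu>\<^sub>G" "\<mu>\<^sub>G \<le> \<mu>\<^sub>F"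
    and F_mono: "\<And>u v w. (u - w) \<bullet> (F u v - F w v) \<ge> \<mu>\<^sub>F * (norm (u - w))\<^sup>2"
    and G_mono: "\<And>v. (v - ystar) \<bullet> G (H v) v \<ge> \<mu>\<^sub>G * (norm (v - ystar))\<^sup>2"
    and noise_indep: "prob_space.indep_vars M (\<lambda>_. borel) (case_sum \<xi> \<psi>) (UNIV :: (nat + nat) set)"
    and noise_square_integrable:
      "\<And>k. integrable M (\<lambda>\<omega>. \<xi> k \<omega> \<bullet> \<xi> k \<omega>)"
      "\<And>k. integrable M (\<lambda>\<omega>. \<psi> k \<omega> \<bullet> \<psi> k \<omega>)"
    and noise_mean:
      "\<And>k. prob_space.expectation M (\<xi> k) = 0"
      "\<And>k. prob_space.expectation M (\<psi> k) = 0"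
    and noise_cond_mean:
      "\<And>k. AE \<omega> in M. vec_cond_exp M (Q k) (\<xi> k) \<omega> = 0"
      "\<And>k. AE \<omega> in M. vec_cond_exp M (Q k) (\<psi> k) \<omega> = 0"
    and noise_cond_variance:
      "\<And>k. AE \<omega> in M. real_cond_exp M (Q k) (\<lambda>\<omega>'. \<xi> k \<omega>' \<bullet> \<xi> k \<omega>') \<omega> = \<Gamma>\<^sub>1\<^sub>1"
      "\<And>k. AE \<omega> in M. real_cond_exp M (Q k) (\<lambda>\<omega>'. \<psi> k \<omega>' \<bullet> \<psi> k \<omega>') \<omega> = \<Gamma>\<^sub>2\<^sub>2"
    and \<Gamma>_nonneg: "\<Gamma>\<^sub>1\<^sub>1 \<ge> 0" "\<Gamma>\<^sub>2\<^sub>2 \<ge> 0"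
    and init_measurable:
      "x 0 \<in> borel_measurable M" "y 0 \<in> borel_measurable M"
      "f 0 \<in> borel_measurable M" "g 0 \<in> borel_measurable M"
    and init_square_integrable:
      "integrable M (\<lambda>\<omega>. (norm (x 0 \<omega>))\<^sup>2)" "integrable M (\<lambda>\<omega>. (norm (y 0 \<omega>))\<^sup>2)"
      "integrable M (\<lambda>\<omega>. (norm (f 0 \<omega>))\<^sup>2)" "integrable M (\<lambda>\<omega>. (norm (g 0 \<omega>))\<^sup>2)"
    and iterates:
      "\<And>k \<omega>. \<omega> \<in> space M \<Longrightarrow>
         f (Suc k) \<omega> = (1 - lam k) *\<^sub>R f k \<omega> + lam k *\<^sub>R (F (x k \<omega>) (y k \<omega>) + \<xi> k \<omega>)"
      "\<And>k \<omega>. \<omega> \<in> space M \<Longrightarrow> x (Suc k) \<omega> = x k \<omega> - \<alpha> k *\<^sub>R f k \<omega>"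
      "\<And>k \<omega>. \<omega> \<in> space M \<Longrightarrow>
         g (Suc k) \<omega> = (1 - \<gamma> k) *\<^sub>R g k \<omega> + \<gamma> k *\<^sub>R (G (x k \<omega>) (y k \<omega>) + \<psi> k \<omega>)"
      "\<And>k \<omega>. \<omega> \<in> space M \<Longrightarrow> y (Suc k) \<omega> = y k \<omega> - \<beta> k *\<^sub>R g k \<omega>"
    and constants_pos: "C\<^sub>l > 0" "C\<^sub>g > 0" "C\<^sub>a > 0" "C\<^sub>b > 0" "h > 0"
    and steps:
      "\<And>k. lam k = C\<^sub>l / (real k + h + 1)"
      "\<And>k. \<gamma> k = C\<^sub>g / (real k + h + 1)"
      "\<And>k. \<alpha> k = C\<^sub>a / (real k + h + 1)"
      "\<And>k. \<beta> k = C\<^sub>b / (real k + h + 1)"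
    and step_eq: "\<And>k. lam k = \<gamma> k"
    and step_le: "\<And>k. lam k \<le> 1 / 4"
    and ratio_\<beta>\<alpha>: "\<And>k. \<beta> k / \<alpha> k \<le> \<mu>\<^sub>F * \<mu>\<^sub>G / (32 * L\<^sup>2 * (1 + L) ^ 4)"
    and bound_\<alpha>: "\<And>k. \<alpha> k \<le> min (\<mu>\<^sub>F / (32 * L\<^sup>2 * (L + 1)\<^sup>2)) (\<mu>\<^sub>G / (L ^ 4 * (1 + L)\<^sup>2))"
    and ratio_\<alpha>lam: "\<And>k. \<alpha> k / lam k \<le>
      min (1 / (24 * L)) (min (\<mu>\<^sub>G / (144 * (1 + \<mu>\<^sub>G))) (\<mu>\<^sub>G / (192 * L ^ 4 * (1 + L)\<^sup>2)))"
  shows "\<forall>k.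
    prob_space.expectation M
      (\<lambda>\<omega>. lyapunov F G H ystar (f (Suc k) \<omega>) (g (Suc k) \<omega>) (x (Suc k) \<omega>) (y (Suc k) \<omega>))
    \<le> (1 - \<mu>\<^sub>G * \<beta> k) *
        prob_space.expectation M (\<lambda>\<omega>. lyapunov F G H ystar (f k \<omega>) (g k \<omega>) (x k \<omega>) (y k \<omega>))
      + 2 * (lam k)\<^sup>2 * prob_space.expectation M (\<lambda>\<omega>. (norm (\<xi> k \<omega>))\<^sup>2 + (norm (\<psi> k \<omega>))\<^sup>2)"
proof -
  interpret prob_space M by (rule prob)
  interpret two_time_scale F G H xstar ystar L \<mu>\<^sub>F \<mu>\<^sub>G
    by unfold_locales (fact root H_root L_pos H_lip F_lip G_lip \<mu>_bounds F_mono G_mono)+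
  let ?I = "{x 0, y 0, f 0, g 0}"
  have \<xi>: "sq_integrable M (\<xi> k)" and \<psi>: "sq_integrable M (\<psi> k)" for k
  proof -
    have "case_sum \<xi> \<psi> i \<in> borel_measurable M" for i
      using noise_indep by (simp add: indep_vars_def)
    from this[of "Inl k"] this[of "Inr k"] show "sq_integrable M (\<xi> k)" "sq_integrable M (\<psi> k)"
      using noise_square_integrable by (auto simp: sq_integrable_def power2_norm_eq_inner)
  qed
  have sub: "subalgebra M (Q k)" for k
    unfolding Q_def noise_history_def
    by (rule subalgebra_generated_sigma)
      (use init_measurable sq_integrableD(1)[OF \<xi>] sq_integrableD(1)[OF \<psi>] in auto)
  have sub_Suc: "subalgebra (Q (Suc k)) (Q k)" for k
    unfolding Q_def by (rule subalgebra_noise_history_Suc)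
  have space_Q: "space (Q k) = space M" for k
    using sub[of k] by (simp add: subalgebra_def)
  have noise_Q: "\<xi> k \<in> borel_measurable (Q (Suc k))" "\<psi> k \<in> borel_measurable (Q (Suc k))" for k
    unfolding Q_def noise_history_def by (auto intro!: measurable_generated_sigma)
  have FQ: "(\<lambda>\<omega>. F (X \<omega>) (Y \<omega>)) \<in> borel_measurable N"
    and GQ: "(\<lambda>\<omega>. G (X \<omega>) (Y \<omega>)) \<in> borel_measurable N"
    if "X \<in> borel_measurable N" "Y \<in> borel_measurable N" for X Y and N :: "'w measure"
    by (rule borel_measurable_lipschitz2[OF less_imp_le[OF L_pos] F_lip that],
        rule borel_measurable_lipschitz2[OF less_imp_le[OF L_pos] G_lip that])
  have Fsq: "sq_integrable M (\<lambda>\<omega>. F (X \<omega>) (Y \<omega>))"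
    and Gsq: "sq_integrable M (\<lambda>\<omega>. G (X \<omega>) (Y \<omega>))"
    if "sq_integrable M X" "sq_integrable M Y" for X Y
    by (rule sq_integrable_lipschitz2[OF less_imp_le[OF L_pos] F_lip that root(1)],
        rule sq_integrable_lipschitz2[OF less_imp_le[OF L_pos] G_lip that root(2)])
  \<comment> \<open>\<open>Q k\<close> contains the noise strictly before time \<open>k\<close>,
    whereas the noise of time \<open>k\<close> first enters \<open>f (Suc k)\<close> and
    \<open>g (Suc k)\<close>, which are measurable for \<open>Q (Suc k)\<close>.\<close>
  have adapted: "x k \<in> borel_measurable (Q k) \<and> y k \<in> borel_measurable (Q k)
      \<and> f k \<in> borel_measurable (Q k) \<and> g k \<in> borel_measurable (Q k)" for k
  proof (induction k)
    case 0
    show ?case unfolding Q_def noise_history_def by (auto intro!: measurable_generated_sigma)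
  next
    case (Suc k)
    note lift = measurable_from_subalg[OF sub_Suc[of k]]
    have "x k \<in> borel_measurable (Q (Suc k))" "y k \<in> borel_measurable (Q (Suc k))"
      "f k \<in> borel_measurable (Q (Suc k))" "g k \<in> borel_measurable (Q (Suc k))"
      using Suc lift by auto
    note [measurable] = this FQ[OF this(1,2)] GQ[OF this(1,2)] noise_Q[of k]
    note iterates_Q = iterates[where k = k, folded space_Q[of "Suc k"]]
    show ?case
      by (intro conjI; rule iterates_Q[THEN measurable_cong[THEN iffD2]]) measurable
  qed
  have sq: "sq_integrable M (x k) \<and> sq_integrable M (y k) \<and> sq_integrable M (f k) \<and> sq_integrable M (g k)"
    for k
  proof (induction k)
    case 0
    show ?case using init_measurable init_square_integrable by (simp add: sq_integrable_def)
  next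
    case (Suc k)
    show ?case
      by (intro conjI; rule iterates[THEN sq_integrable_cong[THEN iffD2]], assumption)
        (intro sq_integrable_add sq_integrable_diff sq_integrable_scaleR Fsq Gsq \<xi> \<psi>; simp add: Suc)+
  qed
  show ?thesis
  proof
    fix k
    let ?V = "\<lambda>k \<omega>. lyapunov F G H ystar (f k \<omega>) (g k \<omega>) (x k \<omega>) (y k \<omega>)"
    let ?x = "\<lambda>\<omega>. x k \<omega> - \<alpha> k *\<^sub>R f k \<omega>" and ?y = "\<lambda>\<omega>. y k \<omega> - \<beta> k *\<^sub>R g k \<omega>"
    \<comment> \<open>\<open>A\<close> and \<open>B\<close> are the new residuals of
      \<open>f\<close> and \<open>g\<close> without the noise of time \<open>k\<close>. The new
      positions \<open>?x\<close> and \<open>?y\<close> use only iterates of time \<open>k\<close>,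
      which makes both \<open>Q k\<close>-measurable and hence orthogonal to \<open>\<xi> k\<close>
      and \<open>\<psi> k\<close>.\<close>
    define A where "A \<omega> = (1 - lam k) *\<^sub>R f k \<omega> + lam k *\<^sub>R F (x k \<omega>) (y k \<omega>) - F (?x \<omega>) (?y \<omega>)" for \<omega>
    define B where "B \<omega> = (1 - lam k) *\<^sub>R g k \<omega> + lam k *\<^sub>R G (x k \<omega>) (y k \<omega>) - G (?x \<omega>) (?y \<omega>)" for \<omega>
    have "x k \<in> borel_measurable (Q k)" "y k \<in> borel_measurable (Q k)"
      "f k \<in> borel_measurable (Q k)" "g k \<in> borel_measurable (Q k)"
      using adapted by auto
    note this[measurable] FQ[OF this(1,2), measurable] GQ[OF this(1,2), measurable]
    have x'Q: "?x \<in> borel_measurable (Q k)" and y'Q: "?y \<in> borel_measurable (Q k)" by measurable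
    note FQ[OF x'Q y'Q, measurable] GQ[OF x'Q y'Q, measurable]
    have AQ: "A \<in> borel_measurable (Q k)" and BQ: "B \<in> borel_measurable (Q k)"
      unfolding A_def B_def by measurable
    have A: "sq_integrable M A" and B: "sq_integrable M B"
      unfolding A_def B_def
      by (intro sq_integrable_add sq_integrable_diff sq_integrable_scaleR Fsq Gsq; simp add: sq)+
    have cross: "expectation (\<lambda>\<omega>. A \<omega> \<bullet> \<xi> k \<omega>) = 0" "expectation (\<lambda>\<omega>. B \<omega> \<bullet> \<psi> k \<omega>) = 0"
      by (rule expectation_inner_eq_0[OF sub AQ A \<xi> noise_cond_mean(1)],
          rule expectation_inner_eq_0[OF sub BQ B \<psi> noise_cond_mean(2)])
    have steps_k: "step_sizes L \<mu>\<^sub>F \<mu>\<^sub>G (\<alpha> k) (\<beta> k) (lam k)"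
    proof
      have "0 < real k + h + 1" using constants_pos by simp
      then show pos: "0 < \<alpha> k" "0 < \<beta> k" "0 < lam k" using constants_pos by (simp_all add: steps)
      show "32 * L\<^sup>2 * (1 + L) ^ 4 * \<beta> k \<le> \<alpha> k * \<mu>\<^sub>F * \<mu>\<^sub>G"
        using ratio_\<beta>\<alpha>[of k] pos L_pos by (simp add: field_simps)
      have "\<alpha> k \<le> \<mu>\<^sub>F / (32 * L\<^sup>2 * (1 + L)\<^sup>2)" using bound_\<alpha>[of k] by (simp add: add.commute)
      then show "32 * L\<^sup>2 * (1 + L)\<^sup>2 * \<alpha> k \<le> \<mu>\<^sub>F"
        using L_pos by (simp add: pos_le_divide_eq mult_ac)
      have "\<alpha> k / lam k \<le> 1 / (24 * L)" "\<alpha> k / lam k \<le> \<mu>\<^sub>G / (144 * (1 + \<mu>\<^sub>G))"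
        "\<alpha> k / lam k \<le> \<mu>\<^sub>G / (192 * L ^ 4 * (1 + L)\<^sup>2)"
        using ratio_\<alpha>lam[of k] by auto
      then show "24 * L * \<alpha> k \<le> lam k" "144 * (1 + \<mu>\<^sub>G) * \<alpha> k \<le> lam k * \<mu>\<^sub>G"
        "192 * L ^ 4 * (1 + L)\<^sup>2 * \<alpha> k \<le> lam k * \<mu>\<^sub>G"
        using pos L_pos \<mu>_bounds by (simp_all add: pos_le_divide_eq pos_divide_le_eq mult_ac)
    qed (use \<mu>_bounds n_le_L step_le in auto)
    have int_noise: "integrable M (\<lambda>\<omega>. (norm (\<xi> k \<omega>))\<^sup>2 + (norm (\<psi> k \<omega>))\<^sup>2)"
      using sq_integrableD(2)[OF \<xi>] sq_integrableD(2)[OF \<psi>] by auto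
    have int_cross: "integrable M (\<lambda>\<omega>. A \<omega> \<bullet> \<xi> k \<omega>)" "integrable M (\<lambda>\<omega>. B \<omega> \<bullet> \<psi> k \<omega>)"
      by (intro integrable_inner_sq A B \<xi> \<psi>)+
    have int_V: "integrable M (?V j)" for j
      by (rule integrable_lyapunov[OF prob]) (simp_all add: sq)
    have pointwise: "?V (Suc k) \<omega> \<le> (1 - \<mu>\<^sub>G * \<beta> k) * ?V k \<omega>
        + (2 * lam k) * (A \<omega> \<bullet> \<xi> k \<omega>) + (2 * lam k) * (B \<omega> \<bullet> \<psi> k \<omega>)
        + (lam k)\<^sup>2 * ((norm (\<xi> k \<omega>))\<^sup>2 + (norm (\<psi> k \<omega>))\<^sup>2)"
      if \<omega>: "\<omega> \<in> space M" for \<omega>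
    proof -
      have expand: "(norm (p + c *\<^sub>R q))\<^sup>2 = (norm p)\<^sup>2 + (2 * c) * (p \<bullet> q) + c\<^sup>2 * (norm q)\<^sup>2"
        for p q :: "real ^ 'n" and c
        using norm_diff_scaleR_squared[of p "- c" q] by (simp add: power_mult_distrib)
      have "f (Suc k) \<omega> - F (?x \<omega>) (?y \<omega>) = A \<omega> + lam k *\<^sub>R \<xi> k \<omega>"
        "g (Suc k) \<omega> - G (?x \<omega>) (?y \<omega>) = B \<omega> + lam k *\<^sub>R \<psi> k \<omega>"
        using \<omega> step_eq[of k] by (simp_all add: iterates A_def B_def algebra_simps)
      then have "?V (Suc k) \<omega> = lyapunov F G H ystar ((1 - lam k) *\<^sub>R f k \<omega> + lam k *\<^sub>R F (x k \<omega>) (y k \<omega>))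
          ((1 - lam k) *\<^sub>R g k \<omega> + lam k *\<^sub>R G (x k \<omega>) (y k \<omega>)) (?x \<omega>) (?y \<omega>)
        + (2 * lam k) * (A \<omega> \<bullet> \<xi> k \<omega>) + (2 * lam k) * (B \<omega> \<bullet> \<psi> k \<omega>)
        + (lam k)\<^sup>2 * ((norm (\<xi> k \<omega>))\<^sup>2 + (norm (\<psi> k \<omega>))\<^sup>2)"
        unfolding lyapunov_def iterates(2,4)[OF \<omega>]
        by (simp add: expand distrib_left flip: A_def B_def)
      then show ?thesis
        using lyapunov_descent[OF steps_k, of "f k \<omega>" "x k \<omega>" "y k \<omega>" "g k \<omega>"] by simp
    qed
    have "expectation (?V (Suc k)) \<le> expectation (\<lambda>\<omega>. (1 - \<mu>\<^sub>G * \<beta> k) * ?V k \<omega>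
        + (2 * lam k) * (A \<omega> \<bullet> \<xi> k \<omega>) + (2 * lam k) * (B \<omega> \<bullet> \<psi> k \<omega>)
        + (lam k)\<^sup>2 * ((norm (\<xi> k \<omega>))\<^sup>2 + (norm (\<psi> k \<omega>))\<^sup>2))"
      by (rule integral_mono[OF int_V _ pointwise])
        (intro Bochner_Integration.integrable_add integrable_mult_right int_V int_cross int_noise)
    also have "\<dots> = (1 - \<mu>\<^sub>G * \<beta> k) * expectation (?V k)
        + (lam k)\<^sup>2 * expectation (\<lambda>\<omega>. (norm (\<xi> k \<omega>))\<^sup>2 + (norm (\<psi> k \<omega>))\<^sup>2)"
      by (simp only: Bochner_Integration.integral_add Bochner_Integration.integrable_add
          integrable_mult_right integral_mult_right_zero int_V int_cross int_noise cross mult_zero_right add_0_right)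
    \<comment> \<open>The cross terms vanish exactly, so the noise enters with coefficient
      \<open>(lam k)\<^sup>2\<close>; the stated factor 2 is reached by enlarging a nonnegative
      term.\<close>
    also have "\<dots> \<le> (1 - \<mu>\<^sub>G * \<beta> k) * expectation (?V k)
        + 2 * (lam k)\<^sup>2 * expectation (\<lambda>\<omega>. (norm (\<xi> k \<omega>))\<^sup>2 + (norm (\<psi> k \<omega>))\<^sup>2)"
      by (intro add_left_mono mult_right_mono Bochner_Integration.integral_nonneg) auto
    finally show "expectation (?V (Suc k)) \<le> (1 - \<mu>\<^sub>G * \<beta> k) * expectation (?V k)
        + 2 * (lam k)\<^sup>2 * expectation (\<lambda>\<omega>. (norm (\<xi> k \<omega>))\<^sup>2 + (norm (\<psi> k \<omega>))\<^sup>2)" .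
  qed
qed

end
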